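(* Let $P=[p_{ij}]$ be an $m\times m$ pattern of term-rank $m$ with $p_{11}=p_{22}=\cdots=p_{mm}=1$. Let $0=\sigma_1<\sigma_2<\cdots<\sigma_m$ be real numbers. Then there exists a real matrix with pattern $P$ and singular values $\sigma_1,\ldots,\sigma_m$ if and only if the digraph of $P$ contains a (directed) cycle of length two or more.
   Context: A pattern is a matrix with entries in $\{0,1\}$. A real matrix $A$ has pattern $P$ if $P$ is obtained from $A$ by replacing each nonzero entry by $1$. The singular values of an $m\times m$ matrix $A$ are the $m$ nonnegative square roots of the eigenvalues of $AA^\top$. The term-rank of a matrix is the largest number of nonzero entries with no two in the same row or the same column. The digraph of an $m\times m$ pattern $P$ with all diagonal entries equal to $1$ has vertices $1,\ldots,m$ and an arc from $i$ to $j$ if and only if $i\ne j$ and $p_{ij}\neq 0$ (so there are no loops). *)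

theory Defs
  imports
    "HOL-Analysis.Analysis"
    "HOL-Computational_Algebra.Polynomial"
    "HOL-Library.Multiset"
    "Graph_Theory.Digraph"
    "Graph_Theory.Arc_Walk"
begin

definition is_pattern :: "real^'n^'m \<Rightarrow> bool" where
  "is_pattern P \<longleftrightarrow> (\<forall>i j. P $ i $ j \<in> {0, 1})"

definition pattern_of :: "real^'n^'m \<Rightarrow> real^'n^'m" where
  "pattern_of A = (\<chi> i j. if A $ i $ j = 0 then 0 else 1)"

definition has_pattern :: "real^'n^'m \<Rightarrow> real^'n^'m \<Rightarrow> bool" where
  "has_pattern A P \<longleftrightarrow> pattern_of A = P"

text \<open>Positions are pairs (row, column); injectivity of \<^term>\<open>fst\<close> and \<^term>\<open>snd\<close> on a set of
  positions says that no two of them share a row or a column.\<close>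

definition term_rank :: "real^'n^'m \<Rightarrow> nat" where
  "term_rank A = Max {card S | S :: ('m \<times> 'n) set.
     S \<subseteq> {(i, j). A $ i $ j \<noteq> 0} \<and> inj_on fst S \<and> inj_on snd S}"

text \<open>The characteristic polynomial is the determinant of \<open>X I - A\<close>, taken over the ring of
  polynomials. Its roots, with their multiplicities, are the eigenvalues. The singular values
  form a multiset, so that their multiplicities are recorded; for real \<open>A\<close> all eigenvalues of
  \<open>A A\<^sup>T\<close> are real and nonnegative, so the multiset has \<open>CARD('n)\<close> elements and
  \<^term>\<open>sqrt\<close> is only applied to nonnegative numbers.\<close>

definition charpoly :: "real^'n^'n \<Rightarrow> real poly" where
  "charpoly A = det (\<chi> i j. (if i = j then [:0, 1:] else 0) - [:A $ i $ j:])"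

definition singular_values :: "real^'n^'n \<Rightarrow> real multiset" where
  "singular_values A = image_mset sqrt (proots (charpoly (A ** transpose A)))"

definition pattern_digraph :: "real^'n^'n \<Rightarrow> ('n, 'n \<times> 'n) pre_digraph" where
  "pattern_digraph P =
     \<lparr>verts = UNIV, arcs = {(i, j). i \<noteq> j \<and> P $ i $ j \<noteq> 0}, tail = fst, head = snd\<rparr>"

end

theory Submission
  imports Defs "HOL-Combinatorics.Cycles"
begin

text \<open>A matrix with pattern \<open>P\<close> and singular value \<open>0\<close> is singular, so its Leibniz expansion has a
  nonzero term besides the diagonal one, and the nontrivial permutation belonging to it closes up to
  a cycle.

  Conversely, a cycle gives a nontrivial permutation \<open>p\<close> along arcs; take one of minimal
  support, and assign the singular values \<open>s i\<close> to the indices so that \<open>s v = 0\<close> for some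
  \<open>v\<close> moved by \<open>p\<close>. Fix the entries on \<open>p\<close> as \<open>e\<close> and the other
  off-diagonal entries of the pattern as \<open>e\<^sup>2\<close>, and let the diagonal \<open>x\<close> range over a
  small box around \<open>s\<close>. For \<open>e = 0\<close> the matrix is diagonal, and the equations saying that
  all \<open>s i\<close> are singular values change sign between opposite faces of the box. This persists for
  small \<open>e\<close>, so by the Poincare-Miranda theorem there is a solution \<open>x\<close> in the box.
  It has \<open>x $ v \<noteq> 0\<close>, because otherwise the term of \<open>p\<close> would dominate the
  determinant, which is \<open>0\<close>.\<close>

section \<open>Zeros of vector fields on a box, and positivity under small perturbations\<close>

text \<open>Clamping \<open>x + F x\<close> to the box coordinatewise gives a continuous self-map,
  so Brouwer supplies a fixed point. A coordinate of it with \<open>F x $ i\<close> nonzero would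
  have to be held back by the clamp at a face towards which \<open>F\<close> points outwards,
  against the sign conditions.\<close>

lemma poincare_miranda:
  fixes F :: "real^'n \<Rightarrow> real^'n"
  assumes cont: "continuous_on (cbox a b) F"
    and ab: "\<And>i. a $ i \<le> b $ i"
    and lower: "\<And>x i. x \<in> cbox a b \<Longrightarrow> x $ i = a $ i \<Longrightarrow> F x $ i \<ge> 0"
    and upper: "\<And>x i. x \<in> cbox a b \<Longrightarrow> x $ i = b $ i \<Longrightarrow> F x $ i \<le> 0"
  obtains x where "x \<in> cbox a b" "F x = 0"
proof -
  define G where "G x = (\<chi> i. max (a $ i) (min (b $ i) (x $ i + F x $ i)))" for x
  have ne: "cbox a b \<noteq> {}"
    using ab by (simp add: interval_ne_empty_cart)
  have "continuous_on (cbox a b) G"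
    unfolding G_def
    by (intro continuous_on_vec_lambda continuous_on_max continuous_on_min continuous_intros
        continuous_on_component cont)
  moreover have "G \<in> cbox a b \<rightarrow> cbox a b"
    using ab by (auto simp: G_def mem_box_cart)
  ultimately obtain x where x: "x \<in> cbox a b" "G x = x"
    using brouwer[OF compact_cbox convex_box(1) ne] by metis
  have "F x $ i = 0" for i
  proof -
    have fx: "max (a $ i) (min (b $ i) (x $ i + F x $ i)) = x $ i"
      using x(2) by (auto simp: G_def vec_eq_iff)
    show ?thesis
      using fx lower[OF x(1), of i] upper[OF x(1), of i] ab[of i]
      by (auto simp: max_def min_def split: if_splits)
  qed
  then show thesis
    using that x(1) by (simp add: vec_eq_iff)
qed

text \<open>The tube lemma makes positivity at parameter 0 uniform over \<open>K\<close>. This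
  carries the signs on the faces of the box from \<open>e = 0\<close> to small positive
  \<open>e\<close>.\<close>

lemma eventually_pos_on_compact:
  fixes f :: "real \<times> 'a::topological_space \<Rightarrow> real"
  assumes "continuous_on UNIV f" "compact K" "\<And>y. y \<in> K \<Longrightarrow> f (0, y) > 0"
  shows "eventually (\<lambda>e. \<forall>y\<in>K. f (e, y) > 0) (at_right 0)"
proof -
  have "open {z. 0 < f z}"
    by (intro open_Collect_less continuous_on_const assms(1))
  then obtain X where X: "0 \<in> X" "open X" "X \<times> K \<subseteq> {z. 0 < f z}"
    using Elementary_Topology.tube_lemma[OF assms(2), of "{z. 0 < f z}" 0] assms(3) by auto
  have "eventually (\<lambda>e. e \<in> X) (at_right 0)"
    using X by (intro eventually_at_topological[THEN iffD2]) auto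
  then show ?thesis
    by eventually_elim (use X(3) in auto)
qed

section \<open>Determinants, characteristic polynomials and singular values\<close>

lemma continuous_on_det:
  fixes A :: "'a::topological_space \<Rightarrow> real^'n^'n"
  assumes "continuous_on S A"
  shows "continuous_on S (\<lambda>x. det (A x))"
  unfolding det_def
  by (intro continuous_on_sum continuous_on_prod continuous_on_mult continuous_on_const
      continuous_on_component assms)

lemma poly_det:
  fixes M :: "real poly^'n^'n"
  shows "poly (det M) x = det (\<chi> i j. poly (M $ i $ j) x)"
  by (simp add: det_def poly_sum poly_prod of_int_poly)

lemma poly_charpoly: "poly (charpoly M) x = det (mat x - M)"
  unfolding charpoly_def poly_det
  by (rule arg_cong[of _ _ det]) (auto simp: vec_eq_iff mat_def)

lemma degree_charpoly_le: "degree (charpoly (M :: real^'n^'n)) \<le> CARD('n)"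
  unfolding charpoly_def det_def
proof (rule degree_sum_le)
  fix p :: "'n \<Rightarrow> 'n"
  let ?N = "(\<chi> i j. (if i = j then [:0, 1:] else 0) - [:M $ i $ j:]) :: real poly^'n^'n"
  have "degree (?N $ i $ j) \<le> 1" for i j
    by (auto intro: degree_diff_le)
  then have "degree (\<Prod>i\<in>UNIV. ?N $ i $ p i) \<le> (\<Sum>i\<in>(UNIV :: 'n set). 1)"
    by (intro order_trans[OF degree_prod_sum_le] sum_mono) auto
  then show "degree (of_int (sign p) * (\<Prod>i\<in>UNIV. ?N $ i $ p i)) \<le> CARD('n)"
    by (simp add: sign_def)
qed auto

text \<open>The value -1 is not an eigenvalue, since an eigenvector would make the sum of two
  squared norms vanish. Membership in \<open>proots\<close> means being a root only for a nonzero
  polynomial.\<close>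

lemma charpoly_gram_nonzero:
  fixes A :: "real^'n^'n"
  shows "charpoly (A ** transpose A) \<noteq> 0"
proof
  assume "charpoly (A ** transpose A) = 0"
  then have "det (mat (-1) - A ** transpose A) = 0"
    by (metis poly_charpoly poly_0)
  then obtain x where x: "x \<noteq> 0" "(mat (-1) - A ** transpose A) *v x = 0"
    by (metis invertible_det_nz invertible_left_inverse matrix_left_invertible_ker)
  have "mat (-1) *v x = - x"
    by (simp add: vec_eq_iff matrix_vector_mult_def mat_def if_distrib[of "\<lambda>c. c * _"] cong: if_cong)
  then have "- x - A *v (transpose A *v x) = 0"
    using x(2) by (simp add: matrix_vector_mult_diff_rdistrib matrix_vector_mul_assoc del: transpose_matrix_vector)
  then have "x \<bullet> (- x - A *v (transpose A *v x)) = 0"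
    by simp
  moreover have "x \<bullet> (A *v (transpose A *v x)) = (transpose A *v x) \<bullet> (transpose A *v x)"
    by (simp add: dot_lmul_matrix flip: vector_transpose_matrix)
  ultimately have "x \<bullet> x + (transpose A *v x) \<bullet> (transpose A *v x) = 0"
    by (simp add: inner_diff_right)
  then show False
    using x(1) by (metis add_nonneg_eq_0_iff inner_eq_zero_iff inner_ge_zero)
qed

text \<open>Distinct roots as many as the degree bound exhaust a nonzero polynomial, so no
  multiplicities have to be computed. Nonnegativity keeps the squares distinct and lets
  \<open>sqrt\<close> undo them.\<close>

lemma singular_values_eqI:
  fixes A :: "real^'n^'n"
  assumes "inj s" "\<And>i. s i \<ge> 0" "\<And>i. det (mat ((s i)\<^sup>2) - A ** transpose A) = 0"
  shows "singular_values A = image_mset s (mset_set (UNIV :: 'n set))"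
proof -
  let ?q = "charpoly (A ** transpose A)"
  let ?S = "(\<lambda>i. (s i)\<^sup>2) ` UNIV"
  have inj: "inj (\<lambda>i. (s i)\<^sup>2)"
    using assms(1,2) by (auto simp: inj_def)
  have "?S \<subseteq> set_mset (proots ?q)"
    using assms(3) by (auto simp: charpoly_gram_nonzero poly_charpoly)
  then have "mset_set ?S \<subseteq># proots ?q"
    by (metis finite_set_mset mset_set_set_mset_msubset msubset_mset_set_iff finite_imageI
        finite subset_mset.order_trans)
  moreover have "size (proots ?q) \<le> size (mset_set ?S)"
    using order_trans[OF size_proots_le degree_charpoly_le[of "A ** transpose A"]]
    by (simp add: card_image[OF inj])
  ultimately have "proots ?q = mset_set ?S"
    by (metis mset_subset_size leD subset_mset.le_less)
  also have "\<dots> = image_mset (\<lambda>i. (s i)\<^sup>2) (mset_set UNIV)"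
    by (simp add: image_mset_mset_set[OF inj])
  finally show ?thesis
    by (simp add: singular_values_def multiset.map_comp o_def assms(2))
qed

lemma det_eq_0_if_zero_singular_value:
  assumes "0 \<in># singular_values A"
  shows "det A = 0"
proof -
  \<comment> \<open>\<open>sqrt\<close> vanishes only at 0, so 0 itself is an eigenvalue.\<close>
  from assms have "poly (charpoly (A ** transpose A)) 0 = 0"
    by (auto simp: singular_values_def charpoly_gram_nonzero)
  then have "det (mat 0 - A ** transpose A) = 0"
    by (simp add: poly_charpoly)
  then have "\<not> invertible (- (A ** transpose A))"
    by (simp add: invertible_det_nz mat_def zero_vec_def[symmetric])
  show ?thesis
  proof (rule ccontr)
    assume "det A \<noteq> 0"
    then have "det (A ** transpose A) \<noteq> 0"
      by (simp add: det_mul)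
    then obtain B where "(A ** transpose A) ** B = mat 1" "B ** (A ** transpose A) = mat 1"
      by (metis invertible_det_nz invertible_def)
    then have "(- (A ** transpose A)) ** (- B) = mat 1" "(- B) ** (- (A ** transpose A)) = mat 1"
      by (simp_all add: matrix_matrix_mult_def vec_eq_iff)
    with \<open>\<not> invertible (- (A ** transpose A))\<close> show False
      unfolding invertible_def by blast
  qed
qed

section \<open>Cycles of the digraph as permutations along arcs\<close>

text \<open>A cycle is turned into a permutation by sending each tail to its head and fixing all
  other vertices. Conversely, iterating the permutation from a moved point gives a closed walk,
  which contains a cycle; the absence of loops yields the length bound.\<close>

lemma exists_cycle_iff_permutation:
  fixes P :: "real^'n^'n"
  shows "(\<exists>c. pre_digraph.cycle (pattern_digraph P) c \<and> length c \<ge> 2) \<longleftrightarrow>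
    (\<exists>p. p permutes UNIV \<and> p \<noteq> id \<and> (\<forall>i. p i \<noteq> i \<longrightarrow> P $ i $ p i \<noteq> 0))" (is "?L \<longleftrightarrow> ?R")
proof -
  interpret D: loopfree_digraph "pattern_digraph P"
    by unfold_locales (auto simp: pattern_digraph_def)
  have [simp]: "head (pattern_digraph P) = snd" "tail (pattern_digraph P) = fst"
    "verts (pattern_digraph P) = UNIV"
    "arcs (pattern_digraph P) = {(i, j). i \<noteq> j \<and> P $ i $ j \<noteq> 0}"
    by (simp_all add: pattern_digraph_def)
  show ?thesis
  proof
    assume ?L
    then obtain u c where c: "D.awalk u c u" "distinct (tl (D.awalk_verts u c))" "length c \<ge> 2"
      by (auto simp: D.cycle_def)
    have ne: "c \<noteq> []" using c(3) by auto
    have arcs: "set c \<subseteq> {(i, j). i \<noteq> j \<and> P $ i $ j \<noteq> 0}" and cas: "D.cas u c u"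
      using c(1) by (auto simp: D.awalk_def)
    \<comment> \<open>The vertex sequence is read off once from the tails and once from the heads.
      As the walk is closed, tails and heads form the same multiset, so the tails are distinct
      too.\<close>
    have "map fst c @ [snd (last c)] = D.awalk_verts u c"
      using ne by (simp add: D.awalk_verts_conv)
    also have verts: "\<dots> = fst (hd c) # map snd c"
      using D.awalk_verts_conv'[OF cas] ne by simp
    finally have eq: "map fst c @ [snd (last c)] = fst (hd c) # map snd c" .
    have dsnd: "distinct (map snd c)"
      using c(2) verts by simp
    have "fst (hd c) = snd (last c)"
      using ne D.awhd_if_cas[OF cas] D.awlast_if_cas[OF cas]
      by (simp add: D.awalk_verts_conv hd_map hd_append)
    then have "mset (map fst c) = mset (map snd c)"
      using arg_cong[OF eq, of mset] by simp
    then have dfst: "distinct (map fst c)" and sets: "fst ` set c = snd ` set c"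
      using dsnd by (metis mset_eq_imp_distinct_iff, metis set_map mset_eq_setD)
    define p where "p i = (if i \<in> fst ` set c then the (map_of c i) else i)" for i
    have p: "p i = j" if "(i, j) \<in> set c" for i j
      using that dfst by (auto simp: p_def image_iff)
    have "p ` (fst ` set c) = snd ` set c"
      using p by (force simp: image_iff)
    then have "bij_betw p (fst ` set c) (fst ` set c)"
      using sets by (metis bij_betw_def finite_imageI finite_set finite_surj_inj subset_refl)
    then have "p permutes (fst ` set c)"
      by (rule bij_imp_permutes) (simp add: p_def)
    then have "p permutes UNIV"
      by (rule permutes_subset) simp
    moreover have "p \<noteq> id"
    proof -
      obtain i j where "(i, j) \<in> set c" using ne by (cases c) auto
      then show ?thesis using p arcs by fastforce
    qed
    moreover have "P $ i $ p i \<noteq> 0" if "p i \<noteq> i" for i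
    proof -
      from that obtain j where "(i, j) \<in> set c"
        by (auto simp: p_def split: if_splits)
      then show ?thesis using p arcs by auto
    qed
    ultimately show ?R by blast
  next
    assume ?R
    then obtain p where p: "p permutes UNIV" "p \<noteq> id" "\<And>i. p i \<noteq> i \<Longrightarrow> P $ i $ p i \<noteq> 0"
      by blast
    then obtain v where v: "p v \<noteq> v" by fastforce
    have "permutation p"
      using p(1) by (auto simp: permutation_permutes)
    \<comment> \<open>\<open>n\<close> need not be the length of the orbit of \<open>v\<close>: the
      walk may run around it several times, as only a nonempty closed walk is required.\<close>
    then obtain n where n: "p ^^ n = id" "n > 0"
      by (rule permutation_is_nilpotent)
    have inj: "inj (p ^^ k)" for k
      using permutes_inj[OF p(1)] by (rule inj_fn)
    have "(p ^^ k) (p v) \<noteq> (p ^^ k) v" for k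
      using v inj[of k] by (auto simp: inj_def)
    then have moved: "p ((p ^^ k) v) \<noteq> (p ^^ k) v" for k
      by (metis funpow_swap1)
    define c where "c a k = map (\<lambda>j. ((p ^^ j) a, (p ^^ Suc j) a)) [0..<k]" for a k
    have c_Suc: "c a (Suc k) = (a, p a) # c (p a) k" for a k
      unfolding c_def upt_conv_Cons[OF zero_less_Suc]
      by (simp add: map_Suc_upt[symmetric] funpow_swap1 del: upt_Suc)
    have "D.cas a (c a k) ((p ^^ k) a)" for a k
    proof (induction k arbitrary: a)
      case 0
      then show ?case by (simp add: c_def)
    next
      case (Suc k)
      then show ?case by (simp add: c_Suc funpow_swap1)
    qed
    from this[of v n] have "D.cas v (c v n) v"
      using n by simp
    moreover have "set (c v n) \<subseteq> arcs (pattern_digraph P)"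
      by (auto simp: c_def moved moved[symmetric] p(3))
    ultimately have "D.closed_w (c v n)"
      using n(2) unfolding D.closed_w_def D.awalk_def by (auto simp: c_def)
    then show ?L
      using D.closed_w_imp_cycle D.cycle_digraph_conv by (metis D.cycle_def)
  qed
qed

section \<open>Dominance of one permutation in the Leibniz expansion\<close>

text \<open>The permutation \<open>p\<close> contributes a term of order \<open>e ^ k\<close>, where \<open>k\<close> is the
  size of its support. A permutation that moves \<open>v\<close> has a support of size at least \<open>k\<close>, and it
  contributes at least one factor \<open>e\<^sup>2\<close> if it differs from \<open>p\<close> and its support has size \<open>k\<close>.\<close>

lemma det_nonzero_if_dominant_permutation:
  fixes A :: "real^'n^'n" and p :: "'n \<Rightarrow> 'n"
  assumes p: "p permutes UNIV" "p v \<noteq> v"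
    and minimal: "\<And>q. q permutes UNIV \<Longrightarrow> q \<noteq> id \<Longrightarrow> (\<And>i. q i \<noteq> i \<Longrightarrow> A $ i $ q i \<noteq> 0) \<Longrightarrow>
      card {i. p i \<noteq> i} \<le> card {i. q i \<noteq> i}"
    and Av: "A $ v $ v = 0"
    and diag_ge: "\<And>i. i \<noteq> v \<Longrightarrow> c \<le> \<bar>A $ i $ i\<bar>" and c: "0 < c" "c \<le> 1"
    and diag_le: "\<And>i. \<bar>A $ i $ i\<bar> \<le> M" and M: "1 \<le> M"
    and e: "0 < e" "e \<le> 1"
    and on_p: "\<And>i. p i \<noteq> i \<Longrightarrow> \<bar>A $ i $ p i\<bar> = e"
    and off_p: "\<And>i j. j \<noteq> i \<Longrightarrow> j \<noteq> p i \<Longrightarrow> \<bar>A $ i $ j\<bar> \<le> e\<^sup>2"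
    and small: "fact CARD('n) * M ^ CARD('n) * e < c ^ CARD('n)"
  shows "det A \<noteq> 0"
proof
  assume det0: "det A = 0"
  define t where "t q = of_int (sign q) * (\<Prod>i\<in>UNIV. A $ i $ q i)" for q
  have abs_t: "\<bar>t q\<bar> = (\<Prod>i\<in>UNIV. \<bar>A $ i $ q i\<bar>)" for q
    by (simp add: t_def abs_mult abs_prod sign_def)
  have split: "(\<Prod>i\<in>UNIV. f i) = (\<Prod>i\<in>{i. q i \<noteq> i}. f i) * (\<Prod>i\<in>{i. q i = i}. f i)"
    for f :: "'n \<Rightarrow> real" and q :: "'n \<Rightarrow> 'n"
    by (subst prod.union_disjoint[symmetric]) (auto intro: prod.cong)
  define k where "k = card {i. p i \<noteq> i}"
  have card_le: "card X \<le> CARD('n)" for X :: "'n set"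
    by (simp add: card_mono)
  \<comment> \<open>The zero entry at \<open>v\<close> is not a factor because \<open>p\<close>
    moves \<open>v\<close>. Since \<open>c\<close> is at most 1, the exponent may be raised to
    \<open>CARD('n)\<close>.\<close>
  have lower: "e ^ k * c ^ CARD('n) \<le> \<bar>t p\<bar>"
  proof -
    have "(\<Prod>i\<in>{i. p i \<noteq> i}. \<bar>A $ i $ p i\<bar>) = (\<Prod>i\<in>{i. p i \<noteq> i}. e)"
      by (rule prod.cong) (auto simp: on_p)
    then have "(\<Prod>i\<in>{i. p i \<noteq> i}. \<bar>A $ i $ p i\<bar>) = e ^ k"
      by (simp add: k_def)
    moreover have "c ^ CARD('n) \<le> c ^ card {i. p i = i}"
      using c card_le by (intro power_decreasing) auto
    moreover have "(\<Prod>i\<in>{i. p i = i}. c) \<le> (\<Prod>i\<in>{i. p i = i}. \<bar>A $ i $ p i\<bar>)"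
    proof (rule prod_mono)
      fix i assume "i \<in> {i. p i = i}"
      then show "0 \<le> c \<and> c \<le> \<bar>A $ i $ p i\<bar>"
        using c(1) p(2) diag_ge[of i] by auto
    qed
    ultimately show ?thesis
      using e by (simp add: abs_t split[of _ p])
  qed
  have upper: "\<bar>t q\<bar> \<le> e ^ Suc k * M ^ CARD('n)" if q: "q permutes UNIV" "q \<noteq> p" for q
  proof (cases "\<exists>i. A $ i $ q i = 0")
    case True
    then have "t q = 0"
      by (auto simp: t_def)
    then show ?thesis using e M by simp
  next
    case False
    \<comment> \<open>A nonvanishing term has to avoid the zero diagonal entry at \<open>v\<close>,
      so the identity is no competitor and minimality applies to \<open>q\<close>.\<close>
    then have "q v \<noteq> v"
      using Av by metis
    then have "q \<noteq> id"
      by auto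
    then have ck: "k \<le> card {i. q i \<noteq> i}"
      unfolding k_def using False q(1) by (intro minimal) auto
    have le_e: "\<bar>A $ i $ q i\<bar> \<le> e" if "q i \<noteq> i" for i
    proof (cases "q i = p i")
      case True
      then show ?thesis using that on_p[of i] by simp
    next
      case False
      have "e\<^sup>2 \<le> e" using e by (simp add: power2_eq_square mult_left_le)
      then show ?thesis using off_p[OF that False] by linarith
    qed
    have "(\<Prod>i\<in>{i. q i \<noteq> i}. \<bar>A $ i $ q i\<bar>) \<le> e ^ Suc k"
    \<comment> \<open>A larger support gives the extra factor \<open>e\<close> by its size alone;
      for equal size it must come from an entry off \<open>p\<close>.\<close>
    proof (cases "k = card {i. q i \<noteq> i}")
      case False
      have "(\<Prod>i\<in>{i. q i \<noteq> i}. \<bar>A $ i $ q i\<bar>) \<le> (\<Prod>i\<in>{i. q i \<noteq> i}. e)"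
        using le_e by (intro prod_mono) auto
      also have "\<dots> \<le> e ^ Suc k"
        using False ck e by (simp del: power_Suc add: power_decreasing)
      finally show ?thesis .
    next
      case True
      have "\<exists>i. q i \<noteq> i \<and> q i \<noteq> p i"
      proof (rule ccontr)
        assume "\<not> ?thesis"
        then have eq: "q i = p i" if "q i \<noteq> i" for i
          using that by blast
        then have "{i. q i \<noteq> i} \<subseteq> {i. p i \<noteq> i}" by force
        then have supp: "{i. q i \<noteq> i} = {i. p i \<noteq> i}"
          using True by (intro card_subset_eq) (auto simp: k_def)
        have "q i = p i" for i
        proof (cases "q i = i")
          case True
          then have "i \<notin> {i. p i \<noteq> i}"
            unfolding supp[symmetric] by simp
          then show ?thesis
            using True by simp
        qed (rule eq)
        then show False
          using q(2) by blast
      qed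
      then obtain i where i: "q i \<noteq> i" "q i \<noteq> p i"
        by blast
      have "(\<Prod>i\<in>{i. q i \<noteq> i}. \<bar>A $ i $ q i\<bar>) =
        \<bar>A $ i $ q i\<bar> * (\<Prod>i\<in>{i. q i \<noteq> i} - {i}. \<bar>A $ i $ q i\<bar>)"
        using i by (intro prod.remove) auto
      also have "\<dots> \<le> e\<^sup>2 * (\<Prod>i\<in>{i. q i \<noteq> i} - {i}. e)"
        using le_e i off_p by (intro mult_mono prod_mono prod_nonneg) auto
      also have "\<dots> = e\<^sup>2 * e ^ (k - 1)"
        using i True by simp
      also have "\<dots> = e ^ Suc k"
      proof -
        have "k > 0" using True i by (auto simp: card_gt_0_iff)
        then show ?thesis by (cases k) (auto simp: power2_eq_square)
      qed
      finally show ?thesis .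
    qed
    moreover have "(\<Prod>i\<in>{i. q i = i}. \<bar>A $ i $ q i\<bar>) \<le> M ^ CARD('n)"
    proof -
      have "(\<Prod>i\<in>{i. q i = i}. \<bar>A $ i $ q i\<bar>) \<le> (\<Prod>i\<in>{i. q i = i}. M)"
        using diag_le by (intro prod_mono) auto
      also have "\<dots> \<le> M ^ CARD('n)"
        using M card_le by (simp add: power_increasing)
      finally show ?thesis .
    qed
    ultimately show ?thesis
      unfolding abs_t split[of _ q] using e by (intro mult_mono prod_nonneg) auto
  qed
  let ?Q = "{q. q permutes (UNIV :: 'n set)}"
  have "det A = t p + (\<Sum>q\<in>?Q - {p}. t q)"
    unfolding det_def t_def using p(1) by (intro sum.remove) (auto simp: finite_permutations)
  then have "\<bar>t p\<bar> = \<bar>\<Sum>q\<in>?Q - {p}. t q\<bar>"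
    using det0 by simp
  also have "\<dots> \<le> (\<Sum>q\<in>?Q - {p}. \<bar>t q\<bar>)"
    by (rule sum_abs)
  also have "\<dots> \<le> (\<Sum>q\<in>?Q - {p}. e ^ Suc k * M ^ CARD('n))"
    by (rule sum_mono) (use upper in auto)
  also have "\<dots> \<le> (\<Sum>q\<in>?Q. e ^ Suc k * M ^ CARD('n))"
    using e M by (intro sum_mono2) (auto simp: finite_permutations)
  \<comment> \<open>One factor \<open>e\<close> remains after extracting \<open>e ^ k\<close>, and
    it absorbs the number of permutations and the diagonal bound.\<close>
  also have "\<dots> = e ^ k * (fact CARD('n) * M ^ CARD('n) * e)"
    by (simp add: card_permutations[of "UNIV :: 'n set" "CARD('n)"])
  also have "\<dots> < e ^ k * c ^ CARD('n)"
    using small e by simp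
  finally show False
    using lower by simp
qed

section \<open>Solving for the diagonal inside a small box\<close>

lemma finite_type_gap:
  fixes s :: "'n::finite \<Rightarrow> real"
  assumes "inj s"
  obtains g where "0 < g" "g \<le> 1" "\<And>i j. i \<noteq> j \<Longrightarrow> g \<le> \<bar>s i - s j\<bar>"
proof
  \<comment> \<open>The element 1 keeps the set nonempty when the type has a single element, and it
    caps the gap.\<close>
  let ?D = "insert 1 ((\<lambda>(i, j). \<bar>s i - s j\<bar>) ` {(i, j). i \<noteq> j})"
  show "0 < Min ?D"
    using assms by (auto simp: inj_def)
  show "Min ?D \<le> 1"
    by (rule Min_le) auto
  show "Min ?D \<le> \<bar>s i - s j\<bar>" if "i \<noteq> j" for i j
    using that by (intro Min_le) auto
qed

text \<open>Indexing the values by rows ties each \<open>s i\<close> to a diagonal position and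
  places the value 0 at a row moved by \<open>p\<close>. Minimality serves to exclude a zero
  diagonal entry there.\<close>

lemma exists_matrix_with_singular_values:
  fixes P :: "real^'n^'n" and s :: "'n \<Rightarrow> real"
  assumes diag: "\<And>i. P $ i $ i \<noteq> 0"
    and s: "inj s" "\<And>i. s i \<ge> 0" "s v = 0"
    and p: "p permutes UNIV" "p v \<noteq> v" "\<And>i. p i \<noteq> i \<Longrightarrow> P $ i $ p i \<noteq> 0"
    and minimal: "\<And>q. q permutes UNIV \<Longrightarrow> q \<noteq> id \<Longrightarrow> (\<And>i. q i \<noteq> i \<Longrightarrow> P $ i $ q i \<noteq> 0) \<Longrightarrow>
      card {i. p i \<noteq> i} \<le> card {i. q i \<noteq> i}"
  obtains A :: "real^'n^'n" where "\<And>i j. A $ i $ j = 0 \<longleftrightarrow> P $ i $ j = 0"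
    "singular_values A = image_mset s (mset_set UNIV)"
proof -
  obtain g where g: "0 < g" "g \<le> 1" "\<And>i j. i \<noteq> j \<Longrightarrow> g \<le> \<bar>s i - s j\<bar>"
    using finite_type_gap[OF s(1)] by blast
  \<comment> \<open>With half the gap, an entry within \<open>\<eta>\<close> of \<open>s j\<close>
    stays at least \<open>\<eta>\<close> away from every other \<open>s i\<close>.\<close>
  define \<eta> where "\<eta> = g / 2"
  have \<eta>: "0 < \<eta>" "\<eta> \<le> 1" "\<And>i j. i \<noteq> j \<Longrightarrow> 2 * \<eta> \<le> \<bar>s i - s j\<bar>"
    using g by (auto simp: \<eta>_def)
  have s_ge: "2 * \<eta> \<le> s i" if "i \<noteq> v" for i
    using \<eta>(3)[OF that] s(2)[of i] s(3) by simp
  define a b :: "real^'n" where "a = (\<chi> i. s i - \<eta>)" and "b = (\<chi> i. s i + \<eta>)"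
  have box: "\<bar>x $ i - s i\<bar> \<le> \<eta>" if "x \<in> cbox a b" for x i
  proof -
    have "s i - \<eta> \<le> x $ i" "x $ i \<le> s i + \<eta>"
      using that by (auto simp: mem_box_cart a_def b_def)
    then show ?thesis by linarith
  qed
  have x_ge: "\<eta> \<le> x $ i" if "x \<in> cbox a b" "i \<noteq> v" for x i
    using box[OF that(1), of i] s_ge[OF that(2)] by linarith
  \<comment> \<open>The case \<open>x $ j = - s i\<close> is excluded because
    \<open>s i + s j\<close> is at least the distance of \<open>s i\<close> and
    \<open>s j\<close>.\<close>
  have sq_neq: "(s i)\<^sup>2 \<noteq> (x $ j)\<^sup>2" if "x \<in> cbox a b" "i \<noteq> j" for x i j
    using box[OF that(1), of j] \<eta>(1) \<eta>(3)[OF that(2)] s(2)[of i] s(2)[of j]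
    by (auto simp: power2_eq_iff)
  define A :: "real \<Rightarrow> real^'n \<Rightarrow> real^'n^'n" where
    "A e x = (\<chi> i j. if i = j then x $ i else if P $ i $ j = 0 then 0
      else if j = p i then e else e\<^sup>2)" for e x
  \<comment> \<open>At \<open>v\<close> the equation uses \<open>det A\<close> itself: the
    determinant of \<open>A ** transpose A\<close> is its square and would not change sign. The
    extra products do not vanish on the box; at \<open>e = 0\<close> they complete the remaining
    factors to a square, leaving the sign of \<open>s i - x $ i\<close>.\<close>
  define F :: "real \<Rightarrow> real^'n \<Rightarrow> real^'n" where
    "F e x = (\<chi> i. if i = v then - det (A e x) * (\<Prod>j\<in>UNIV - {v}. x $ j)
      else det (mat ((s i)\<^sup>2) - A e x ** transpose (A e x)) *
        (\<Prod>j\<in>UNIV - {i}. (s i)\<^sup>2 - (x $ j)\<^sup>2))" for e x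
  have F_0: "\<exists>w>0. F 0 x $ i = (s i - x $ i) * w" if x: "x \<in> cbox a b" for x i
  proof (cases "i = v")
    case True
    let ?w = "\<Prod>j\<in>UNIV - {v}. x $ j"
    have "det (A 0 x) = (\<Prod>j\<in>UNIV. x $ j)"
      by (subst det_diagonal) (auto simp: A_def)
    also have "\<dots> = x $ v * ?w"
      by (rule prod.remove) auto
    finally have "F 0 x $ i = (s i - x $ i) * ?w\<^sup>2"
      using True s(3) by (simp add: F_def power2_eq_square)
    moreover have "x $ j \<noteq> 0" if "j \<noteq> v" for j
      using x_ge[OF x that] \<eta>(1) by simp
    then have "?w\<^sup>2 > 0"
      by auto
    ultimately show ?thesis by blast
  next
    case False
    let ?w = "\<Prod>j\<in>UNIV - {i}. (s i)\<^sup>2 - (x $ j)\<^sup>2"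
    have "mat ((s i)\<^sup>2) - A 0 x ** transpose (A 0 x) =
      (\<chi> k l. if k = l then (s i)\<^sup>2 - (x $ k)\<^sup>2 else 0)"
      by (auto simp: vec_eq_iff A_def mat_def matrix_matrix_mult_def transpose_def
          power2_eq_square if_distrib[of "\<lambda>c. c * _"] cong: if_cong)
    then have "det (mat ((s i)\<^sup>2) - A 0 x ** transpose (A 0 x)) =
      (\<Prod>j\<in>UNIV. (s i)\<^sup>2 - (x $ j)\<^sup>2)"
      by (simp add: det_diagonal)
    also have "\<dots> = ((s i)\<^sup>2 - (x $ i)\<^sup>2) * ?w"
      by (rule prod.remove) auto
    finally have "F 0 x $ i = ((s i)\<^sup>2 - (x $ i)\<^sup>2) * ?w * ?w"
      using False by (simp add: F_def)
    also have "\<dots> = (s i - x $ i) * ((s i + x $ i) * ?w\<^sup>2)"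
      by (simp add: power2_eq_square square_diff_square_factored)
    finally have "F 0 x $ i = (s i - x $ i) * ((s i + x $ i) * ?w\<^sup>2)" .
    moreover have "s i + x $ i > 0"
      using x_ge[OF x False] \<eta>(1) s(2)[of i] by linarith
    moreover have "?w\<^sup>2 > 0"
      using sq_neq[OF x] by auto
    ultimately show ?thesis by (meson mult_pos_pos)
  qed
  have cont_A: "continuous_on UNIV (\<lambda>z. A (fst z) (snd z))"
    unfolding A_def
  proof (intro continuous_on_vec_lambda)
    fix i j
    show "continuous_on UNIV (\<lambda>z :: real \<times> (real^'n). if i = j then snd z $ i else if P $ i $ j = 0 then 0
      else if j = p i then fst z else (fst z)\<^sup>2)"
      by (cases "i = j"; cases "P $ i $ j = 0"; cases "j = p i") (auto intro!: continuous_intros)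
  qed
  have cont_gram: "continuous_on UNIV (\<lambda>z. mat c - A (fst z) (snd z) ** transpose (A (fst z) (snd z)))"
    for c
    unfolding matrix_matrix_mult_def transpose_def
    by (intro continuous_on_diff continuous_on_vec_lambda continuous_on_sum continuous_on_mult
        continuous_on_const) (auto intro!: continuous_on_component cont_A)
  have cont_F: "continuous_on UNIV (\<lambda>z. F (fst z) (snd z))"
    unfolding F_def
  proof (rule continuous_on_vec_lambda)
    fix i
    show "continuous_on UNIV (\<lambda>z. if i = v
      then - det (A (fst z) (snd z)) * (\<Prod>j\<in>UNIV - {v}. snd z $ j)
      else det (mat ((s i)\<^sup>2) - A (fst z) (snd z) ** transpose (A (fst z) (snd z))) *
        (\<Prod>j\<in>UNIV - {i}. (s i)\<^sup>2 - (snd z $ j)\<^sup>2))"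
      by (cases "i = v") (auto intro!: continuous_intros continuous_on_det cont_A cont_gram)
  qed
  have face: "compact (cbox a b \<inter> {x. x $ i = c})" for i c
    by (intro compact_Int_closed compact_cbox closed_Collect_eq continuous_intros)
  have "eventually (\<lambda>e. \<forall>x\<in>cbox a b \<inter> {x. x $ i = a $ i}. F e x $ i > 0) (at_right 0)" for i
  proof -
    have "continuous_on UNIV (\<lambda>z. F (fst z) (snd z) $ i)"
      by (intro continuous_on_component cont_F)
    moreover have "F 0 x $ i > 0" if "x \<in> cbox a b \<inter> {x. x $ i = a $ i}" for x
      using that F_0[of x i] \<eta>(1) by (auto simp: a_def)
    ultimately show ?thesis
      using eventually_pos_on_compact[OF _ face, of "\<lambda>z. F (fst z) (snd z) $ i"] by simp
  qed
  moreover have "eventually (\<lambda>e. \<forall>x\<in>cbox a b \<inter> {x. x $ i = b $ i}. - F e x $ i > 0) (at_right 0)" for i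
  proof -
    have "continuous_on UNIV (\<lambda>z. - F (fst z) (snd z) $ i)"
      by (intro continuous_on_component continuous_on_minus cont_F)
    moreover have "- F 0 x $ i > 0" if "x \<in> cbox a b \<inter> {x. x $ i = b $ i}" for x
      using that F_0[of x i] \<eta>(1) by (auto simp: b_def)
    ultimately show ?thesis
      using eventually_pos_on_compact[OF _ face, of "\<lambda>z. - F (fst z) (snd z) $ i"] by simp
  qed
  \<comment> \<open>The summand 1 leaves room for the deviation \<open>\<eta>\<close>, so
    \<open>M\<close> bounds all diagonal entries in the box.\<close>
  moreover define M where "M = 1 + (\<Sum>i\<in>UNIV. s i)"
  define B where "B = fact CARD('n) * M ^ CARD('n)"
  have s_le: "s i \<le> M - 1" for i
    unfolding M_def using s(2) by (simp add: member_le_sum)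
  have M: "M \<ge> 1"
    using s_le[of v] s(3) by simp
  have B: "B > 0"
    using M by (simp add: B_def)
  \<comment> \<open>The bound by \<open>\<eta> ^ CARD('n) / B\<close> is the smallness condition of
    the dominance lemma with \<open>c = \<eta>\<close>.\<close>
  have "eventually (\<lambda>e. e \<in> {0<..<min 1 (\<eta> ^ CARD('n) / B)}) (at_right 0)"
    using \<eta>(1) B by (intro eventually_at_right_real) auto
  ultimately have "eventually (\<lambda>e. e \<in> {0<..<min 1 (\<eta> ^ CARD('n) / B)} \<and>
      (\<forall>i. \<forall>x\<in>cbox a b \<inter> {x. x $ i = a $ i}. F e x $ i > 0) \<and>
      (\<forall>i. \<forall>x\<in>cbox a b \<inter> {x. x $ i = b $ i}. - F e x $ i > 0)) (at_right 0)"
    by (intro eventually_conj eventually_all_finite)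
  from eventually_happens'[OF trivial_limit_at_right_real this]
  obtain e where e_small: "e \<in> {0<..<min 1 (\<eta> ^ CARD('n) / B)}"
    and faces: "\<forall>i. \<forall>x\<in>cbox a b \<inter> {x. x $ i = a $ i}. F e x $ i > 0"
      "\<forall>i. \<forall>x\<in>cbox a b \<inter> {x. x $ i = b $ i}. - F e x $ i > 0"
    by blast
  have e: "0 < e" "e < 1" "e < \<eta> ^ CARD('n) / B"
    using e_small by auto
  have lower: "F e x $ i \<ge> 0" if "x \<in> cbox a b" "x $ i = a $ i" for x i
    using that faces(1) by (simp add: less_imp_le)
  have upper: "F e x $ i \<le> 0" if "x \<in> cbox a b" "x $ i = b $ i" for x i
    using that faces(2) by (simp add: less_imp_le)
  have "continuous_on (cbox a b) (\<lambda>x. F (fst (e, x)) (snd (e, x)))"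
    by (rule continuous_on_compose2[OF cont_F]) (auto intro!: continuous_intros)
  then have "continuous_on (cbox a b) (F e)"
    by simp
  then obtain x where x: "x \<in> cbox a b" "F e x = 0"
    by (rule poincare_miranda[OF _ _ lower upper]) (use \<eta>(1) in \<open>auto simp: a_def b_def\<close>)
  have Fx: "F e x $ i = 0" for i
    using x(2) by simp
  \<comment> \<open>The other diagonal entries are nonzero, so their product cancels from the
    equation at \<open>v\<close>.\<close>
  have det0: "det (A e x) = 0"
    using Fx[of v] x_ge[OF x(1)] \<eta>(1) by (force simp: F_def)
  have "x $ v \<noteq> 0"
  proof
    assume xv: "x $ v = 0"
    have "det (A e x) \<noteq> 0"
    proof (rule det_nonzero_if_dominant_permutation[OF p(1,2), where c = \<eta> and M = M and e = e])
      show "card {i. p i \<noteq> i} \<le> card {i. q i \<noteq> i}"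
        if "q permutes UNIV" "q \<noteq> id" "\<And>i. q i \<noteq> i \<Longrightarrow> A e x $ i $ q i \<noteq> 0" for q
      proof (rule minimal[OF that(1,2)])
        fix i assume "q i \<noteq> i"
        with that(3)[of i] show "P $ i $ q i \<noteq> 0"
          by (auto simp: A_def)
      qed
      show "\<bar>A e x $ i $ i\<bar> \<le> M" for i
        using box[OF x(1), of i] s(2)[of i] s_le[of i] \<eta>(2) by (simp add: A_def)
      show "\<bar>A e x $ i $ j\<bar> \<le> e\<^sup>2" if "j \<noteq> i" "j \<noteq> p i" for i j
        using that by (auto simp: A_def)
      show "fact CARD('n) * M ^ CARD('n) * e < \<eta> ^ CARD('n)"
        using e(3) B by (simp add: B_def field_simps)
      show "\<eta> \<le> \<bar>A e x $ i $ i\<bar>" if "i \<noteq> v" for i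
        using x_ge[OF x(1) that] by (simp add: A_def)
      show "\<bar>A e x $ i $ p i\<bar> = e" if "p i \<noteq> i" for i
        using that p(3) e(1) by (auto simp: A_def)
    qed (use \<eta> M e xv in \<open>auto simp: A_def\<close>)
    then show False using det0 by simp
  qed
  show thesis
  proof (rule that)
    have "x $ i \<noteq> 0" for i
      using \<open>x $ v \<noteq> 0\<close> x_ge[OF x(1), of i] \<eta>(1) by (cases "i = v") auto
    then show "A e x $ i $ j = 0 \<longleftrightarrow> P $ i $ j = 0" for i j
      using e diag by (auto simp: A_def)
    show "singular_values (A e x) = image_mset s (mset_set UNIV)"
    proof (rule singular_values_eqI[OF s(1,2)])
      fix i
      show "det (mat ((s i)\<^sup>2) - A e x ** transpose (A e x)) = 0"
      proof (cases "i = v")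
        case True
        \<comment> \<open>For the value 0 the eigenvalue equation is recovered from the singularity
          of \<open>A e x\<close>.\<close>
        have "mat 0 - A e x ** transpose (A e x) = (- A e x) ** transpose (A e x)"
          by (simp add: matrix_matrix_mult_def vec_eq_iff mat_def sum_negf)
        then show ?thesis
          using True s(3) det0 by (simp add: det_mul)
      next
        case False
        then show ?thesis
          using Fx[of i] sq_neq[OF x(1)] by (force simp: F_def)
      qed
    qed
  qed
qed

section \<open>Zero as a singular value against cycles of the pattern\<close>

theorem theorem5p3:
  fixes P :: "real^'n^'n" and \<sigma> :: "nat \<Rightarrow> real"
  assumes "is_pattern P"
    and "term_rank P = CARD('n)"
    and "\<And>i. P $ i $ i = 1"
    and "\<sigma> 1 = 0"
    and "strict_mono_on {1..CARD('n)} \<sigma>"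
  shows "(\<exists>A :: real^'n^'n. has_pattern A P \<and>
            singular_values A = image_mset \<sigma> (mset_set {1..CARD('n)})) \<longleftrightarrow>
         (\<exists>c. pre_digraph.cycle (pattern_digraph P) c \<and> length c \<ge> 2)"
  unfolding exists_cycle_iff_permutation
proof
  assume "\<exists>A :: real^'n^'n. has_pattern A P \<and>
    singular_values A = image_mset \<sigma> (mset_set {1..CARD('n)})"
  then obtain A :: "real^'n^'n" where A: "has_pattern A P"
    "singular_values A = image_mset \<sigma> (mset_set {1..CARD('n)})"
    by blast
  have nz: "A $ i $ j = 0 \<longleftrightarrow> P $ i $ j = 0" for i j
    using A(1) by (auto simp: has_pattern_def pattern_of_def split: if_splits)
  have "\<sigma> 1 \<in># image_mset \<sigma> (mset_set {1..CARD('n)})"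
    by auto
  then have det0: "det A = 0"
    using A(2) assms(4) by (metis det_eq_0_if_zero_singular_value)
  show "\<exists>p. p permutes UNIV \<and> p \<noteq> id \<and> (\<forall>i. p i \<noteq> i \<longrightarrow> P $ i $ p i \<noteq> 0)"
  proof (rule ccontr)
    assume none: "\<not> ?thesis"
    \<comment> \<open>Otherwise only the identity contributes to the determinant, with a product of
      nonzero diagonal entries.\<close>
    have "(\<Prod>i\<in>UNIV. A $ i $ p i) = 0" if "p permutes UNIV" "p \<noteq> id" for p
      using none that nz by auto
    then have "det A = (\<Sum>p\<in>{id}. of_int (sign p) * (\<Prod>i\<in>UNIV. A $ i $ p i))"
      unfolding det_def
      by (intro sum.mono_neutral_right) (auto simp: permutes_id finite_permutations)
    then show False
      using det0 nz assms(3) by (simp add: sign_id)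
  qed
next
  let ?perm = "\<lambda>p. p permutes UNIV \<and> p \<noteq> id \<and> (\<forall>i. p i \<noteq> i \<longrightarrow> P $ i $ p i \<noteq> 0)"
  assume "\<exists>p. ?perm p"
  then obtain p where p: "?perm p"
    and minimal: "\<And>q. ?perm q \<Longrightarrow> card {i. p i \<noteq> i} \<le> card {i. q i \<noteq> i}"
    using ex_has_least_nat[of ?perm _ "\<lambda>p. card {i. p i \<noteq> i}"] by blast
  then obtain v where v: "p v \<noteq> v"
    by fastforce
  obtain f where f: "bij_betw f (UNIV :: 'n set) {1..CARD('n)}" "f v = 1"
  proof -
    obtain h where h: "bij_betw h (UNIV :: 'n set) {1..CARD('n)}"
      by (metis card_atLeastAtMost diff_Suc_1 finite finite_atLeastAtMost finite_same_card_bij)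
    \<comment> \<open>Exchanging the labels 1 and \<open>h v\<close> assigns the value
      \<open>\<sigma> 1 = 0\<close> to \<open>v\<close>.\<close>
    have "bij_betw (Transposition.transpose 1 (h v)) {1..CARD('n)} {1..CARD('n)}"
      using h by (intro permutes_imp_bij permutes_swap_id) (auto simp: bij_betw_def)
    then have "bij_betw (Transposition.transpose 1 (h v) \<circ> h) (UNIV :: 'n set) {1..CARD('n)}"
      using h bij_betw_trans by blast
    then show thesis
      using that by fastforce
  qed
  have "inj_on \<sigma> {1..CARD('n)}"
    by (rule strict_mono_on_imp_inj_on[OF assms(5)])
  then have "inj (\<sigma> \<circ> f)"
    using f(1) by (simp add: bij_betw_def comp_inj_on)
  moreover have "(\<sigma> \<circ> f) i \<ge> 0" for i
  proof -
    have "f i \<in> {1..CARD('n)}"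
      using f(1) by (auto simp: bij_betw_def)
    then have "\<sigma> 1 \<le> \<sigma> (f i)"
      by (intro strict_mono_on_leD[OF assms(5)]) auto
    then show ?thesis
      using assms(4) by simp
  qed
  ultimately obtain A :: "real^'n^'n" where A: "\<And>i j. A $ i $ j = 0 \<longleftrightarrow> P $ i $ j = 0"
    "singular_values A = image_mset (\<sigma> \<circ> f) (mset_set UNIV)"
    using exists_matrix_with_singular_values[of P "\<sigma> \<circ> f" v p] p minimal v assms(3,4) f(2)
    by auto
  have "has_pattern A P"
    using A(1) assms(1) by (auto simp: has_pattern_def pattern_of_def is_pattern_def vec_eq_iff)
  moreover have "singular_values A = image_mset \<sigma> (mset_set {1..CARD('n)})"
    using f(1) by (simp add: A(2) bij_betw_def image_mset_mset_set flip: multiset.map_comp)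
  ultimately show "\<exists>A :: real^'n^'n. has_pattern A P \<and>
    singular_values A = image_mset \<sigma> (mset_set {1..CARD('n)})"
    by blast
qed

end
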